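(* Let $f\colon \mathbb{T}\to\mathbb{C}$ be a starlike embedding. Then \[ |\hat f(1)|+|\hat f(-1)|>0 . \]
   Context: $\mathbb{T}=\{z\in\mathbb{C}\colon |z|=1\}$. For a continuous $f\colon\mathbb{T}\to\mathbb{C}$ and $n\in\mathbb{Z}$, the Fourier coefficients are $\hat f(n)=\frac{1}{2\pi}\int_0^{2\pi} f(e^{i\theta})e^{-in\theta}\,d\theta$. A circle embedding is an injective continuous map $f\colon\mathbb{T}\to\mathbb{C}$. The curve $f(\mathbb{T})$ is called star-shaped about $w_0\in\mathbb{C}$ if the argument of $f(e^{i\theta})-w_0$ is a monotone (not necessarily strictly monotone) function of $\theta$; that is, $w_0\notin f(\mathbb{T})$ and a continuous function $\phi\colon\mathbb{R}\to\mathbb{R}$ with $f(e^{i\theta})-w_0=|f(e^{i\theta})-w_0|\,e^{i\phi(\theta)}$ for all $\theta$ is monotone (either non-decreasing or non-increasing). A starlike embedding is a circle embedding $f$ such that $f(\mathbb{T})$ is star-shaped about some point $w_0\in\mathbb{C}$. Both sense-preserving and sense-reversing embeddings are allowed. *)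

theory Defs
  imports "HOL-Analysis.Analysis"
begin

text \<open>The circle is \<^term>\<open>sphere (0::complex) 1\<close>, and \<^term>\<open>cis \<theta>\<close> is $e^{i\theta}$.
  Maps on the circle are represented by total functions on \<^typ>\<open>complex\<close>; every notion
  below depends only on their values on the circle.\<close>

definition fourier_coeff :: "(complex \<Rightarrow> complex) \<Rightarrow> int \<Rightarrow> complex" where
  "fourier_coeff f n =
     1 / (2 * of_real pi) * integral {0..2 * pi} (\<lambda>\<theta>. f (cis \<theta>) * cis (- (of_int n * \<theta>)))"

definition circle_embedding :: "(complex \<Rightarrow> complex) \<Rightarrow> bool" where
  "circle_embedding f \<longleftrightarrow> continuous_on (sphere 0 1) f \<and> inj_on f (sphere 0 1)"

text \<open>Two continuous arguments \<open>\<phi>\<close> of the same nonvanishing loop differ by a constant multiple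
  of \<open>2 * pi\<close>, so it does not matter which one is required to be monotone.\<close>

definition star_shaped_about :: "(complex \<Rightarrow> complex) \<Rightarrow> complex \<Rightarrow> bool" where
  "star_shaped_about f w0 \<longleftrightarrow>
     w0 \<notin> f ` sphere 0 1 \<and>
     (\<exists>\<phi> :: real \<Rightarrow> real.
        continuous_on UNIV \<phi> \<and>
        (\<forall>\<theta>. f (cis \<theta>) - w0 = of_real (cmod (f (cis \<theta>) - w0)) * cis (\<phi> \<theta>)) \<and>
        (mono \<phi> \<or> antimono \<phi>))"

definition starlike_embedding :: "(complex \<Rightarrow> complex) \<Rightarrow> bool" where
  "starlike_embedding f \<longleftrightarrow> circle_embedding f \<and> (\<exists>w0. star_shaped_about f w0)"

end

theory Submission
  imports Defs "HOL-Complex_Analysis.Riemann_Mapping"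
begin

text \<open>Let \<open>\<phi>\<close> be a monotone continuous argument of \<open>f(e\<^sup>i\<^sup>\<theta>) - w0\<close>. Since a simple closed curve
  has winding number \<open>0\<close> or \<open>\<plusminus>1\<close> about \<open>w0\<close>, the increment of \<open>\<phi>\<close> over a period is \<open>0\<close> or
  \<open>\<plusminus>2 pi\<close>; it is not \<open>0\<close>, for otherwise \<open>\<phi>\<close> would be constant and the curve would lie on a ray.
  By the intermediate value theorem there is \<open>\<alpha>\<close> with \<open>\<phi>(\<alpha> + pi) = \<phi>(\<alpha>) \<plusminus> pi\<close>.
  The line through \<open>w0\<close> in the direction \<open>\<phi>(\<alpha>)\<close> then separates the images of the two half circles
  cut off by \<open>\<alpha>\<close> and \<open>\<alpha> + pi\<close>, so that the component of \<open>f - w0\<close> normal to this line has the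
  same sign pattern as \<open>\<plusminus>sin(\<theta> - \<alpha>)\<close> and is not orthogonal to it. But \<open>sin(\<theta> - \<alpha>)\<close> is a linear
  combination of \<open>e\<^sup>i\<^sup>\<theta>\<close> and \<open>e\<^sup>-\<^sup>i\<^sup>\<theta>\<close>.\<close>

section \<open>Continuous arguments along a loop and the winding number\<close>

text \<open>Distinct integer multiples of \<open>c\<close> are at least \<open>c\<close> apart, so
  \<open>g\<close> has discrete range, and a continuous function with discrete range on a connected
  set cannot jump.\<close>

lemma continuous_int_multiples_constant:
  fixes g :: "'a::topological_space \<Rightarrow> real"
  assumes "connected S" "continuous_on S g" "c > 0"
    and "\<And>x. x \<in> S \<Longrightarrow> \<exists>n::int. g x = c * of_int n"
  shows "g constant_on S"
proof (rule continuous_discrete_range_constant [OF assms(1,2)])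
  fix x assume "x \<in> S"
  then obtain m :: int where m: "g x = c * of_int m"
    using assms(4) by blast
  show "\<exists>e>0. \<forall>y. y \<in> S \<and> g y \<noteq> g x \<longrightarrow> e \<le> norm (g y - g x)"
  proof (intro exI [of _ c] conjI allI impI \<open>c > 0\<close>)
    fix y assume y: "y \<in> S \<and> g y \<noteq> g x"
    then obtain n :: int where n: "g y = c * of_int n"
      using assms(4) by blast
    have "1 \<le> \<bar>n - m\<bar>"
      using y m n by auto
    then have "1 \<le> \<bar>real_of_int (n - m)\<bar>"
      by linarith
    then have "c * 1 \<le> c * \<bar>real_of_int (n - m)\<bar>"
      using \<open>c > 0\<close> by (intro mult_left_mono) auto
    also have "\<dots> = norm (g y - g x)"
      using \<open>c > 0\<close> by (simp add: m n abs_mult flip: right_diff_distrib)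
    finally show "c \<le> norm (g y - g x)"
      by simp
  qed
qed

lemma cis_eq_imp_int_multiple:
  assumes "cis a = cis b"
  shows "\<exists>n::int. a - b = 2 * pi * of_int n"
proof -
  have "cis (a - b) = 1"
    using assms by (simp flip: cis_divide)
  then have "cos (a - b) = 1"
    by (simp add: complex_eq_iff)
  then show ?thesis
    using cos_one_2pi_int by (metis mult.assoc mult.commute)
qed

text \<open>A continuous logarithm \<open>q\<close> of \<open>p - w\<close> gains 2 pi i times the
  winding number along the loop. Its imaginary part and \<phi> are arguments of the same nonzero
  values, so they differ by multiples of 2 pi, hence by a constant.\<close>

lemma argument_increment_eq_winding_number:
  fixes p :: "real \<Rightarrow> complex" and \<phi> :: "real \<Rightarrow> real"
  assumes "path p" "pathfinish p = pathstart p" "w \<notin> path_image p"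
    and \<phi>: "continuous_on {0..1} \<phi>"
    and arg: "\<And>t. t \<in> {0..1} \<Longrightarrow> p t - w = of_real (cmod (p t - w)) * cis (\<phi> t)"
  shows "of_real (\<phi> 1 - \<phi> 0) = 2 * of_real pi * winding_number p w"
proof -
  obtain q where q: "path q"
      "pathfinish q - pathstart q = 2 * of_real pi * \<i> * winding_number p w"
      "\<And>t. t \<in> {0..1} \<Longrightarrow> p t = w + exp (q t)"
    using winding_number_as_continuous_log [OF assms(1,3)] by metis
  have mult: "\<exists>n::int. \<phi> t - Im (q t) = 2 * pi * of_int n" if t: "t \<in> {0..1}" for t
  proof -
    have "of_real (cmod (p t - w)) * cis (\<phi> t) = of_real (cmod (p t - w)) * cis (Im (q t))"
      using arg [OF t] q(3) [OF t] by (simp add: exp_eq_polar norm_mult)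
    moreover have "cmod (p t - w) \<noteq> 0"
      using q(3) [OF t] by simp
    ultimately show ?thesis
      by (intro cis_eq_imp_int_multiple) simp
  qed
  have "(\<lambda>t. \<phi> t - Im (q t)) constant_on {0..1}"
    using q(1) by (intro continuous_int_multiples_constant [where c = "2 * pi"] mult)
      (auto simp: path_def intro!: continuous_intros \<phi>)
  then have "\<phi> 1 - Im (q 1) = \<phi> 0 - Im (q 0)"
    unfolding constant_on_def by force
  then have \<phi>q: "\<phi> 1 - \<phi> 0 = Im (q 1 - q 0)"
    by simp
  \<comment> \<open>The loop is closed, so the modulus returns to its initial value and the
    increment of \<open>q\<close> is purely imaginary.\<close>
  have "exp (q 1) = exp (q 0)"
    using assms(2) q(3) [of 0] q(3) [of 1] by (simp add: pathfinish_def pathstart_def)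
  then have "Re (q 1) = Re (q 0)"
    by (metis exp_inj_iff norm_exp_eq_Re)
  then have "q 1 - q 0 = \<i> * of_real (\<phi> 1 - \<phi> 0)"
    using \<phi>q by (simp add: complex_eq_iff)
  then show ?thesis
    using q(2) by (simp add: pathfinish_def pathstart_def)
qed

section \<open>The increment of the argument of an embedded circle over a period\<close>

lemma continuous_on_circle_compose_cis:
  assumes "continuous_on (sphere 0 1) f" "continuous_on S g"
  shows "continuous_on S (\<lambda>x. f (cis (g x)))"
  by (rule continuous_on_compose2 [OF assms(1) continuous_on_cis [OF assms(2)]]) auto

text \<open>Winding numbers need a parametrisation on the unit interval. Equal values there force an
  integer difference of parameters, of modulus at most 1, and difference 1 occurs only between the
  two endpoints.\<close>

lemma simple_path_circle_embedding:
  assumes "circle_embedding f"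
  shows "simple_path (\<lambda>t. f (cis (2 * pi * t)))"
proof -
  have "continuous_on {0..1} (\<lambda>t. f (cis (2 * pi * t)))"
    using assms unfolding circle_embedding_def
    by (auto intro: continuous_on_circle_compose_cis [where f = f] continuous_on_mult_left)
  moreover have "x = y \<or> x = 0 \<and> y = 1 \<or> x = 1 \<and> y = 0"
    if "x \<in> {0..1}" "y \<in> {0..1}" "f (cis (2 * pi * x)) = f (cis (2 * pi * y))" for x y :: real
  proof -
    have "cis (2 * pi * x) = cis (2 * pi * y)"
      using assms that(3) unfolding circle_embedding_def inj_on_def by simp
    then obtain n :: int where "2 * pi * x - 2 * pi * y = 2 * pi * of_int n"
      using cis_eq_imp_int_multiple by blast
    then have n: "x - y = of_int n"
      by (simp flip: right_diff_distrib)
    with that have "-1 \<le> n" "n \<le> 1"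
      by auto
    then have "n = -1 \<or> n = 0 \<or> n = 1"
      by linarith
    with n that show ?thesis
      by auto
  qed
  ultimately show ?thesis
    unfolding simple_path_def path_def loop_free_def by blast
qed

text \<open>The bound on \<open>k\<close> comes from the winding number of a simple closed curve and
  concerns only the period starting at 0. It carries over to every starting point because the
  increment is a continuous function with values in the multiples of 2 pi.\<close>

lemma circle_embedding_argument_increment:
  fixes \<phi> :: "real \<Rightarrow> real"
  assumes f: "circle_embedding f" and w: "w \<notin> f ` sphere 0 1"
    and \<phi>: "continuous_on UNIV \<phi>"
    and arg: "\<And>\<theta>. f (cis \<theta>) - w = of_real (cmod (f (cis \<theta>) - w)) * cis (\<phi> \<theta>)"
  obtains k :: int where "k \<in> {-1, 0, 1}" "\<And>\<theta>. \<phi> (\<theta> + 2 * pi) = \<phi> \<theta> + 2 * pi * of_int k"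
proof -
  let ?p = "\<lambda>t. f (cis (2 * pi * t))"
  have p: "simple_path ?p" "pathfinish ?p = pathstart ?p" "w \<notin> path_image ?p"
    using f w by (auto simp: simple_path_circle_embedding pathfinish_def pathstart_def path_image_def)
  have wn: "winding_number ?p w \<in> {-1, 0, 1}"
    using simple_closed_path_winding_number_cases [OF p] .
  have "of_real (\<phi> (2 * pi * 1) - \<phi> (2 * pi * 0)) = 2 * of_real pi * winding_number ?p w"
    by (intro argument_increment_eq_winding_number [where \<phi> = "\<lambda>t. \<phi> (2 * pi * t)"] p arg
        continuous_on_compose2 [OF \<phi>] continuous_intros simple_path_imp_path) auto
  then have "complex_of_real (\<phi> (2 * pi) - \<phi> 0) \<in> complex_of_real ` {- (2 * pi), 0, 2 * pi}"
    using wn by auto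
  then have "\<phi> (2 * pi) - \<phi> 0 \<in> {- (2 * pi), 0, 2 * pi}"
    by (metis imageE of_real_eq_iff)
  then obtain k :: int where k: "k \<in> {-1, 0, 1}" "\<phi> (2 * pi) - \<phi> 0 = 2 * pi * of_int k"
    by force
  have "(\<lambda>\<theta>. \<phi> (\<theta> + 2 * pi) - \<phi> \<theta>) constant_on UNIV"
  proof (intro continuous_int_multiples_constant [where c = "2 * pi"] cis_eq_imp_int_multiple)
    fix \<theta>
    have "cmod (f (cis \<theta>) - w) \<noteq> 0"
      using w by auto
    moreover have "cis (\<theta> + 2 * pi) = cis \<theta>"
      by (simp flip: cis_mult)
    ultimately show "cis (\<phi> (\<theta> + 2 * pi)) = cis (\<phi> \<theta>)"
      using arg [of \<theta>] arg [of "\<theta> + 2 * pi"] by (metis mult_cancel_left of_real_eq_0_iff)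
  qed (auto intro!: continuous_intros continuous_on_compose2 [OF \<phi>])
  then have "\<phi> (\<theta> + 2 * pi) - \<phi> \<theta> = \<phi> (0 + 2 * pi) - \<phi> 0" for \<theta>
    unfolding constant_on_def by (metis UNIV_I)
  then have "\<phi> (\<theta> + 2 * pi) = \<phi> \<theta> + 2 * pi * of_int k" for \<theta>
    using k(2) by (simp add: algebra_simps)
  with k(1) that show ?thesis
    by blast
qed

lemma circle_embedding_argument_not_constant:
  assumes f: "circle_embedding f" and w: "w \<notin> f ` sphere 0 1"
    and arg: "\<And>\<theta>. \<theta> \<in> {0..2 * pi} \<Longrightarrow> f (cis \<theta>) - w = of_real (cmod (f (cis \<theta>) - w)) * cis c"
  shows False
proof -
  \<comment> \<open>On a ray the modulus is an injective coordinate, but it takes equal values at some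
    pair of antipodal points.\<close>
  define g where "g \<theta> = cmod (f (cis \<theta>) - w) - cmod (f (cis (\<theta> + pi)) - w)" for \<theta>
  have "continuous_on {0..pi} g"
    using f unfolding circle_embedding_def g_def
    by (intro continuous_intros continuous_on_circle_compose_cis) auto
  moreover have g_pi: "g pi = - g 0"
    unfolding g_def by simp
  moreover have "g 0 \<le> 0 \<and> 0 \<le> g pi \<or> g pi \<le> 0 \<and> 0 \<le> g 0"
    using g_pi by linarith
  ultimately obtain \<theta> where \<theta>: "0 \<le> \<theta>" "\<theta> \<le> pi" "g \<theta> = 0"
    using IVT' [of g 0 0 pi] IVT2' [of g pi 0 0] by force
  then have "f (cis \<theta>) - w = f (cis (\<theta> + pi)) - w"
    using arg [of \<theta>] arg [of "\<theta> + pi"] unfolding g_def by simp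
  then have "cis \<theta> = cis (\<theta> + pi)"
    using f unfolding circle_embedding_def inj_on_def by simp
  moreover have "cis (\<theta> + pi) = - cis \<theta>"
    by (simp flip: cis_mult)
  ultimately show False
    by simp
qed

section \<open>Matching the sign of the normal component with a shifted sine\<close>

text \<open>On the half period after \<alpha>, monotonicity keeps both angles in [0, pi]; on the
  next one both lie in [pi, 2 pi]. So the two sines never have opposite signs. The range of \<theta>
  covers [0, 2 pi] whenever \<alpha> lies there.\<close>

lemma sin_mult_sin_nonneg:
  fixes \<psi> :: "real \<Rightarrow> real"
  assumes "mono \<psi>" and per: "\<And>\<theta>. \<psi> (\<theta> + 2 * pi) = \<psi> \<theta> + 2 * pi"
    and \<alpha>: "\<psi> (\<alpha> + pi) = \<psi> \<alpha> + pi" and \<theta>: "\<alpha> - 2 * pi \<le> \<theta>" "\<theta> \<le> \<alpha> + 2 * pi"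
  shows "0 \<le> sin (\<psi> \<theta> - \<psi> \<alpha>) * sin (\<theta> - \<alpha>)"
proof -
  have *: "0 \<le> sin (\<psi> \<theta> - \<psi> \<alpha>) * sin (\<theta> - \<alpha>)" if "\<alpha> \<le> \<theta>" "\<theta> \<le> \<alpha> + 2 * pi" for \<theta>
  proof (cases "\<theta> \<le> \<alpha> + pi")
    case True
    then have "\<psi> \<alpha> \<le> \<psi> \<theta>" "\<psi> \<theta> \<le> \<psi> \<alpha> + pi"
      using that monoD [OF \<open>mono \<psi>\<close>, of \<alpha> \<theta>] monoD [OF \<open>mono \<psi>\<close>, of \<theta> "\<alpha> + pi"] \<alpha> by auto
    then show ?thesis
      using that True by (intro mult_nonneg_nonneg sin_ge_zero) auto
  next
    case False
    then have "\<psi> \<alpha> + pi \<le> \<psi> \<theta>" "\<psi> \<theta> \<le> \<psi> \<alpha> + 2 * pi"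
      using that monoD [OF \<open>mono \<psi>\<close>, of "\<alpha> + pi" \<theta>]
        monoD [OF \<open>mono \<psi>\<close>, of \<theta> "\<alpha> + 2 * pi"] \<alpha> per [of \<alpha>] by auto
    moreover have "sin x \<le> 0" if "pi \<le> x" "x \<le> 2 * pi" for x
      using sin_ge_zero [of "x - pi"] that by (simp add: sin_diff)
    ultimately show ?thesis
      using that False by (intro mult_nonpos_nonpos) auto
  qed
  show ?thesis
  proof (cases "\<alpha> \<le> \<theta>")
    case False
    \<comment> \<open>For \<theta> below \<alpha>, a shift by one period leaves both sines
      unchanged.\<close>
    have "sin (\<psi> (\<theta> + 2 * pi) - \<psi> \<alpha>) = sin (\<psi> \<theta> - \<psi> \<alpha>)" "sin (\<theta> + 2 * pi - \<alpha>) = sin (\<theta> - \<alpha>)"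
      using sin_periodic [of "\<psi> \<theta> - \<psi> \<alpha>"] sin_periodic [of "\<theta> - \<alpha>"]
      by (simp_all add: per diff_add_eq)
    then show ?thesis
      using * [of "\<theta> + 2 * pi"] False \<theta> by simp
  qed (use * \<theta> in auto)
qed

lemma integral_weighted_sin_mult_sin_nonzero:
  fixes \<psi> r :: "real \<Rightarrow> real"
  assumes cont: "continuous_on UNIV \<psi>" and "mono \<psi>"
    and per: "\<And>\<theta>. \<psi> (\<theta> + 2 * pi) = \<psi> \<theta> + 2 * pi"
    and r: "continuous_on {0..2 * pi} r" "\<And>\<theta>. r \<theta> > 0"
  obtains \<alpha> where "integral {0..2 * pi} (\<lambda>\<theta>. r \<theta> * (sin (\<psi> \<theta> - \<psi> \<alpha>) * sin (\<theta> - \<alpha>))) \<noteq> 0"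
proof -
  define g where "g \<theta> = \<psi> (\<theta> + pi) - \<psi> \<theta>" for \<theta>
  have cg: "continuous_on {0..pi} g"
    unfolding g_def by (intro continuous_intros continuous_on_compose2 [OF cont]) auto
  have g_pi: "g pi = 2 * pi - g 0"
    using per [of 0] by (simp add: g_def)
  \<comment> \<open>The increments over the two half periods add up to 2 pi, so pi lies between
    them.\<close>
  have "g 0 \<le> pi \<and> pi \<le> g pi \<or> g pi \<le> pi \<and> pi \<le> g 0"
    using g_pi by linarith
  then obtain \<alpha> where \<alpha>: "0 \<le> \<alpha>" "\<alpha> \<le> pi" "g \<alpha> = pi"
    using cg IVT' [of g 0 pi pi] IVT2' [of g pi pi 0] by force
  then have \<psi>\<alpha>: "\<psi> (\<alpha> + pi) = \<psi> \<alpha> + pi"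
    by (simp add: g_def)
  define h where "h \<theta> = r \<theta> * (sin (\<psi> \<theta> - \<psi> \<alpha>) * sin (\<theta> - \<alpha>))" for \<theta>
  have ch: "continuous_on {0..2 * pi} h"
    unfolding h_def using continuous_on_subset [OF cont] by (intro continuous_intros r) auto
  have h0: "0 \<le> h \<theta>" if "\<theta> \<in> {0..2 * pi}" for \<theta>
    unfolding h_def using that \<alpha> r(2) [of \<theta>]
    by (intro mult_nonneg_nonneg sin_mult_sin_nonneg [OF \<open>mono \<psi>\<close> per \<psi>\<alpha>]) auto
  \<comment> \<open>A quarter turn past \<psi> \<alpha> makes the first sine equal to 1, so the
    nonnegative \<open>h\<close> is strictly positive there.\<close>
  obtain \<beta> where \<beta>: "\<alpha> \<le> \<beta>" "\<beta> \<le> \<alpha> + pi" "\<psi> \<beta> = \<psi> \<alpha> + pi / 2"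
    using IVT' [of \<psi> \<alpha> "\<psi> \<alpha> + pi / 2" "\<alpha> + pi"] \<psi>\<alpha> continuous_on_subset [OF cont]
    by fastforce
  have "\<beta> \<noteq> \<alpha>" "\<beta> \<noteq> \<alpha> + pi"
    using \<beta>(3) \<psi>\<alpha> pi_gt_zero by force+
  then have "sin (\<beta> - \<alpha>) > 0"
    using \<beta> by (intro sin_gt_zero) auto
  then have "h \<beta> > 0"
    using \<beta>(3) r(2) by (simp add: h_def)
  have "integral {0..2 * pi} h \<noteq> 0"
  proof
    assume "integral {0..2 * pi} h = 0"
    \<comment> \<open>A continuous nonnegative function with zero integral vanishes throughout;
      \<beta> is in the interval because \<alpha> is at most pi.\<close>
    then have "h \<beta> = 0"
      using integral_eq_0_iff [OF ch _ h0] \<alpha> \<beta> by auto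
    with \<open>h \<beta> > 0\<close> show False
      by simp
  qed
  then show ?thesis
    using that by (simp add: h_def [abs_def])
qed

section \<open>Vanishing Fourier coefficients and the contradiction\<close>

text \<open>Both exponentials that make up the shifted sine integrate to 0 against \<open>f\<close>.
  The centre \<open>w\<close> may be subtracted freely, since the sine has mean 0 over a
  period.\<close>

lemma integral_mult_sin_eq_0:
  fixes f :: "complex \<Rightarrow> complex"
  assumes f: "continuous_on (sphere 0 1) f"
    and "fourier_coeff f 1 = 0" "fourier_coeff f (-1) = 0"
  shows "((\<lambda>\<theta>. (f (cis \<theta>) - w) * of_real (sin (\<theta> - \<alpha>))) has_integral 0) {0..2 * pi}"
proof -
  have cf: "continuous_on {0..2 * pi} (\<lambda>\<theta>. f (cis \<theta>))"
    by (rule continuous_on_circle_compose_cis [OF f continuous_on_id])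
  have int: "(\<lambda>\<theta>. f (cis \<theta>) * cis \<theta>) integrable_on {0..2 * pi}"
      "(\<lambda>\<theta>. f (cis \<theta>) * cis (- \<theta>)) integrable_on {0..2 * pi}"
    by (intro integrable_continuous_real continuous_intros cf)+
  have "integral {0..2 * pi} (\<lambda>\<theta>. f (cis \<theta>) * cis \<theta>) = 0"
      "integral {0..2 * pi} (\<lambda>\<theta>. f (cis \<theta>) * cis (- \<theta>)) = 0"
    using assms(2,3) by (simp_all add: fourier_coeff_def)
  then have "((\<lambda>\<theta>. f (cis \<theta>) * cis \<theta>) has_integral 0) {0..2 * pi}"
      "((\<lambda>\<theta>. f (cis \<theta>) * cis (- \<theta>)) has_integral 0) {0..2 * pi}"
    using int by (metis integrable_integral)+
  \<comment> \<open>The two factors are the coefficients of \<open>cis \<theta>\<close> and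
    \<open>cis (- \<theta>)\<close> in Euler's formula for
    \<open>sin (\<theta> - \<alpha>)\<close>.\<close>
  from has_integral_diff [OF has_integral_mult_right [OF this(1), of "cis (- \<alpha>) / (2 * \<i>)"]
      has_integral_mult_right [OF this(2), of "cis \<alpha> / (2 * \<i>)"]]
  have "((\<lambda>\<theta>. cis (- \<alpha>) / (2 * \<i>) * (f (cis \<theta>) * cis \<theta>)
      - cis \<alpha> / (2 * \<i>) * (f (cis \<theta>) * cis (- \<theta>))) has_integral 0) {0..2 * pi}"
    by simp
  moreover have "cis (- \<alpha>) / (2 * \<i>) * (f (cis \<theta>) * cis \<theta>)
      - cis \<alpha> / (2 * \<i>) * (f (cis \<theta>) * cis (- \<theta>)) = f (cis \<theta>) * of_real (sin (\<theta> - \<alpha>))" for \<theta>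
  proof -
    have "(cis (- \<alpha>) * cis \<theta> - cis \<alpha> * cis (- \<theta>)) / (2 * \<i>) = of_real (sin (\<theta> - \<alpha>))"
      by (simp add: complex_eq_iff cis_mult sin_diff cos_diff) (simp add: field_simps)
    moreover have "cis (- \<alpha>) / (2 * \<i>) * (f (cis \<theta>) * cis \<theta>)
        - cis \<alpha> / (2 * \<i>) * (f (cis \<theta>) * cis (- \<theta>))
        = f (cis \<theta>) * ((cis (- \<alpha>) * cis \<theta> - cis \<alpha> * cis (- \<theta>)) / (2 * \<i>))"
      by (simp add: field_simps)
    ultimately show ?thesis
      by simp
  qed
  ultimately have 1: "((\<lambda>\<theta>. f (cis \<theta>) * of_real (sin (\<theta> - \<alpha>))) has_integral 0) {0..2 * pi}"
    by simp
  have "((\<lambda>\<theta>. sin (\<theta> - \<alpha>)) has_integral (- cos (2 * pi - \<alpha>)) - (- cos (0 - \<alpha>))) {0..2 * pi}"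
    by (rule fundamental_theorem_of_calculus)
      (auto intro!: derivative_eq_intros simp flip: has_real_derivative_iff_has_vector_derivative)
  then have "((\<lambda>\<theta>. sin (\<theta> - \<alpha>)) has_integral 0) {0..2 * pi}"
    by (simp add: cos_diff)
  from has_integral_mult_right [OF has_integral_of_real [OF this], of w]
  have "((\<lambda>\<theta>. w * of_real (sin (\<theta> - \<alpha>))) has_integral 0) {0..2 * pi}"
    by simp
  from has_integral_diff [OF 1 this] show ?thesis
    by (simp add: left_diff_distrib)
qed

theorem theorem2p1:
  fixes f :: "complex \<Rightarrow> complex"
  assumes "starlike_embedding f"
  shows "cmod (fourier_coeff f 1) + cmod (fourier_coeff f (-1)) > 0"
proof (rule ccontr)
  assume "\<not> ?thesis"
  then have coeffs: "fourier_coeff f 1 = 0" "fourier_coeff f (-1) = 0"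
    by (smt (verit) norm_ge_zero norm_le_zero_iff)+
  from assms obtain w \<phi> where f: "circle_embedding f" and w: "w \<notin> f ` sphere 0 1"
    and \<phi>: "continuous_on UNIV \<phi>"
    and arg: "\<And>\<theta>. f (cis \<theta>) - w = of_real (cmod (f (cis \<theta>) - w)) * cis (\<phi> \<theta>)"
    and mono: "mono \<phi> \<or> antimono \<phi>"
    unfolding starlike_embedding_def star_shaped_about_def by blast
  have cf: "continuous_on (sphere 0 1) f"
    using f by (simp add: circle_embedding_def)
  \<comment> \<open>The sign \<open>s\<close> records the direction of monotonicity, so that both
    orientations are treated at once through a non-decreasing \<psi>.\<close>
  define s :: real where "s = (if mono \<phi> then 1 else -1)"
  define \<psi> where "\<psi> \<theta> = s * \<phi> \<theta>" for \<theta>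
  have s: "s = 1 \<or> s = -1"
    by (simp add: s_def)
  have "mono \<psi>"
    using mono by (auto simp: \<psi>_def s_def mono_def antimono_def)
  obtain k :: int where k: "k \<in> {-1, 0, 1}" "\<And>\<theta>. \<phi> (\<theta> + 2 * pi) = \<phi> \<theta> + 2 * pi * of_int k"
    using circle_embedding_argument_increment [OF f w \<phi> arg] by blast
  \<comment> \<open>With increment 0 a monotone \<phi> is constant over the period, and the curve
    would lie on a ray from \<open>w\<close>.\<close>
  have "k \<noteq> 0"
  proof
    assume "k = 0"
    have "\<phi> \<theta> = \<phi> 0" if "\<theta> \<in> {0..2 * pi}" for \<theta>
      using that k(2) [of 0] \<open>k = 0\<close> s monoD [OF \<open>mono \<psi>\<close>, of 0 \<theta>]
        monoD [OF \<open>mono \<psi>\<close>, of \<theta> "2 * pi"] by (auto simp: \<psi>_def)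
    then show False
      using circle_embedding_argument_not_constant [OF f w, of "\<phi> 0"] arg by metis
  qed
  \<comment> \<open>The increment of \<psi> is nonnegative, so the sign of \<open>k\<close> agrees
    with \<open>s\<close>.\<close>
  moreover have "0 \<le> s * (2 * pi * of_int k)"
    using monoD [OF \<open>mono \<psi>\<close>, of 0 "2 * pi"] k(2) [of 0] by (simp add: \<psi>_def algebra_simps)
  ultimately have "s * of_int k = 1"
    using k(1) s pi_gt_zero by (auto simp del: pi_gt_zero)
  then have per: "\<psi> (\<theta> + 2 * pi) = \<psi> \<theta> + 2 * pi" for \<theta>
    using k(2) [of \<theta>] by (simp add: \<psi>_def algebra_simps)
  define r where "r \<theta> = cmod (f (cis \<theta>) - w)" for \<theta>
  have "continuous_on UNIV \<psi>"
    unfolding \<psi>_def by (intro continuous_intros \<phi>)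
  moreover have "continuous_on {0..2 * pi} r"
    unfolding r_def
    by (intro continuous_intros continuous_on_circle_compose_cis cf)
  moreover have "r \<theta> > 0" for \<theta>
    using w by (auto simp: r_def)
  ultimately obtain \<alpha> where
    \<alpha>: "integral {0..2 * pi} (\<lambda>\<theta>. r \<theta> * (sin (\<psi> \<theta> - \<psi> \<alpha>) * sin (\<theta> - \<alpha>))) \<noteq> 0"
    using integral_weighted_sin_mult_sin_nonzero [OF _ \<open>mono \<psi>\<close> per] by blast
  \<comment> \<open>The factor \<open>cis (- \<phi> \<alpha>)\<close> rotates the direction \<phi>
    \<alpha> to the positive real axis, so the imaginary part is the component normal to the
    separating line; \<open>s\<close> turns \<phi> into \<psi> because sine is odd.\<close>
  have *: "s * Im (cis (- \<phi> \<alpha>) * ((f (cis \<theta>) - w) * of_real (sin (\<theta> - \<alpha>))))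
      = r \<theta> * (sin (\<psi> \<theta> - \<psi> \<alpha>) * sin (\<theta> - \<alpha>))" for \<theta>
  proof -
    have "cis (- \<phi> \<alpha>) * ((f (cis \<theta>) - w) * of_real (sin (\<theta> - \<alpha>)))
        = of_real (r \<theta> * sin (\<theta> - \<alpha>)) * (cis (- \<phi> \<alpha>) * cis (\<phi> \<theta>))"
      by (subst arg) (simp add: r_def)
    also have "\<dots> = of_real (r \<theta> * sin (\<theta> - \<alpha>)) * cis (\<phi> \<theta> - \<phi> \<alpha>)"
      by (simp add: cis_mult)
    finally have "Im (cis (- \<phi> \<alpha>) * ((f (cis \<theta>) - w) * of_real (sin (\<theta> - \<alpha>))))
        = r \<theta> * sin (\<theta> - \<alpha>) * sin (\<phi> \<theta> - \<phi> \<alpha>)"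
      by (simp only: Im_complex_of_real Re_complex_of_real times_complex.sel cis.sel)
    moreover have "s * sin (\<phi> \<theta> - \<phi> \<alpha>) = sin (\<psi> \<theta> - \<psi> \<alpha>)"
      using s by (auto simp: \<psi>_def sin_diff)
    ultimately show ?thesis
      by (simp add: mult.left_commute mult.commute)
  qed
  \<comment> \<open>The normal component is a real-linear function of the integrand, so its integral
    vanishes as well.\<close>
  have "((\<lambda>\<theta>. s * Im (cis (- \<phi> \<alpha>) * ((f (cis \<theta>) - w) * of_real (sin (\<theta> - \<alpha>)))))
      has_integral s * Im (cis (- \<phi> \<alpha>) * 0)) {0..2 * pi}"
    by (intro has_integral_mult_right has_integral_Im integral_mult_sin_eq_0 cf coeffs)
  then have "((\<lambda>\<theta>. r \<theta> * (sin (\<psi> \<theta> - \<psi> \<alpha>) * sin (\<theta> - \<alpha>))) has_integral 0) {0..2 * pi}"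
    by (simp only: *) simp
  with \<alpha> show False
    by (simp add: integral_unique)
qed

end
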